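(* Let $k\geqslant 4$ be an integer. For $0\leqslant i\leqslant 8$ let $\Gamma_i^{(4),k}$ denote the number of $8\times k$ matrices over $\mathbb{F}_2$ of the form \[ \begin{pmatrix} \alpha_1^{(1)} & \alpha_2^{(1)} & \cdots & \alpha_k^{(1)}\\ \alpha_2^{(1)} & \alpha_3^{(1)} & \cdots & \alpha_{k+1}^{(1)}\\ \alpha_1^{(2)} & \alpha_2^{(2)} & \cdots & \alpha_k^{(2)}\\ \alpha_2^{(2)} & \alpha_3^{(2)} & \cdots & \alpha_{k+1}^{(2)}\\ \alpha_1^{(3)} & \alpha_2^{(3)} & \cdots & \alpha_k^{(3)}\\ \alpha_2^{(3)} & \alpha_3^{(3)} & \cdots & \alpha_{k+1}^{(3)}\\ \alpha_1^{(4)} & \alpha_2^{(4)} & \cdots & \alpha_k^{(4)}\\ \alpha_2^{(4)} & \alpha_3^{(4)} & \cdots & \alpha_{k+1}^{(4)} \end{pmatrix} \] (with $\alpha_j^{(m)}\in\mathbb{F}_2$) having rank $i$ over $\mathbb{F}_2$. Then \[ \Gamma_i^{(4),k}=\begin{cases} 1 & i=0,\\ 45 & i=1,\\ 30\cdot 2^{k}+1410 & i=2,\\ 1470\cdot 2^{k}+31920 & i=3,\\ 140\cdot 2^{2k}+42420\cdot 2^{k}+276640 & i=4,\\ 6300\cdot 2^{2k}+630000\cdot 2^{k}-11692800 & i=5,\\ 120\cdot 2^{3k}+123480\cdot 2^{2k}-6142080\cdot 2^{k}+66170880 & i=6,\\ 3720\cdot 2^{3k}-416640\cdot 2^{2k}+13332480\cdot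 2^{k}-121896960 & i=7,\\ 16\cdot 2^{4k}-3840\cdot 2^{3k}+286720\cdot 2^{2k}-7864320\cdot 2^{k}+2^{26} & i=8. \end{cases} \]
   Context: The matrices counted are "quadruple persymmetric" matrices: they consist of four $2\times k$ blocks stacked vertically, the $m$-th block ($m=1,\dots,4$) being determined by a vector $(\alpha_1^{(m)},\dots,\alpha_{k+1}^{(m)})\in\mathbb{F}_2^{k+1}$, with first row $(\alpha_1^{(m)},\dots,\alpha_k^{(m)})$ and second row $(\alpha_2^{(m)},\dots,\alpha_{k+1}^{(m)})$. The count ranges over all $2^{4(k+1)}$ choices of the entries $\alpha_j^{(m)}$, $1\le j\le k+1$, $1\le m\le 4$. *)

theory Defs
  imports
    "HOL-Library.Z2"
    "HOL-Library.FuncSet"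
    "Jordan_Normal_Form.DL_Rank"
begin

text \<open>The field with two elements is the library type \<^typ>\<open>bit\<close>.  The entry
  \<open>\<alpha> m j\<close> stands for $\alpha_j^{(m)}$ and is 1-based in both arguments, whereas matrix
  indices are 0-based: rows \<open>2 * (m - 1)\<close> and \<open>2 * (m - 1) + 1\<close> form the \<open>m\<close>-th block.\<close>

definition quad_persym_mat :: "nat \<Rightarrow> (nat \<Rightarrow> nat \<Rightarrow> bit) \<Rightarrow> bit mat" where
  "quad_persym_mat k \<alpha> = mat 8 k (\<lambda>(r, c). \<alpha> (r div 2 + 1) (r mod 2 + c + 1))"

definition quad_persym_mats :: "nat \<Rightarrow> bit mat set" where
  "quad_persym_mats k = range (quad_persym_mat k)"

text \<open>The first argument of \<^const>\<open>vec_space.rank\<close> is the number of rows.\<close>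

definition Gamma4 :: "nat \<Rightarrow> nat \<Rightarrow> nat" where
  "Gamma4 i k = card {A \<in> quad_persym_mats k. vec_space.rank 8 A = i}"

text \<open>For \<open>k \<ge> 1\<close> the entries can be read off the matrix, so counting matrices is
  the same as counting the choices of the entries $\alpha_j^{(m)}$, $1 \le m \le 4$,
  $1 \le j \le k+1$.\<close>

lemma quad_persym_mat_bij:
  assumes "k \<ge> 1"
  shows "bij_betw (quad_persym_mat k)
           ({1..4} \<rightarrow>\<^sub>E ({1..k+1} \<rightarrow>\<^sub>E UNIV)) (quad_persym_mats k)"
  unfolding bij_betw_def
proof
  let ?P = "{1..4} \<rightarrow>\<^sub>E ({1..k+1} \<rightarrow>\<^sub>E (UNIV :: bit set))"
  show "inj_on (quad_persym_mat k) ?P"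
  proof (rule inj_onI)
    fix \<alpha> \<beta> assume a: "\<alpha> \<in> ?P" and b: "\<beta> \<in> ?P"
      and eq: "quad_persym_mat k \<alpha> = quad_persym_mat k \<beta>"
    have ent: "\<alpha> (r div 2 + 1) (r mod 2 + c + 1) = \<beta> (r div 2 + 1) (r mod 2 + c + 1)"
      if "r < 8" "c < k" for r c
      using arg_cong[OF eq, of "\<lambda>A. A $$ (r, c)"] that by (simp add: quad_persym_mat_def)
    have "\<alpha> m j = \<beta> m j" if m: "m \<in> {1..4}" and j: "j \<in> {1..k+1}" for m j
    proof (cases "j \<le> k")
      case True
      then show ?thesis using ent[of "2 * (m - 1)" "j - 1"] m j by auto
    next
      case False
      have "(2 * (m - 1) + 1) div 2 = m - 1" "(2 * (m - 1) + 1) mod 2 = 1" by presburger+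
      moreover have "2 * (m - 1) + 1 < 8" "j = k + 1" using m j False by auto
      ultimately show ?thesis
        using ent[of "2 * (m - 1) + 1" "k - 1"] m assms by auto
    qed
    moreover have "\<alpha> m \<in> {1..k+1} \<rightarrow>\<^sub>E UNIV" "\<beta> m \<in> {1..k+1} \<rightarrow>\<^sub>E UNIV" if "m \<in> {1..4}" for m
      using a b that by (auto simp only: PiE_iff)
    ultimately have "\<alpha> m = \<beta> m" if "m \<in> {1..4}" for m
      using that by (meson PiE_ext)
    then show "\<alpha> = \<beta>" using a b by (meson PiE_ext)
  qed
  show "quad_persym_mat k ` ?P = quad_persym_mats k"
  proof
    show "quad_persym_mats k \<subseteq> quad_persym_mat k ` ?P"
    proof
      fix A assume "A \<in> quad_persym_mats k"
      then obtain \<alpha> where A: "A = quad_persym_mat k \<alpha>" by (auto simp: quad_persym_mats_def)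
      let ?\<beta> = "restrict (\<lambda>m. restrict (\<alpha> m) {1..k+1}) {1..4}"
      have "A = quad_persym_mat k ?\<beta>"
        unfolding A quad_persym_mat_def by (rule eq_matI) auto
      moreover have "?\<beta> \<in> ?P" by (auto simp: PiE_iff)
      ultimately show "A \<in> quad_persym_mat k ` ?P" by blast
    qed
  qed (auto simp: quad_persym_mats_def)
qed

end

theory Submission
  imports Defs "HOL-Library.Product_Plus"
begin

text \<open>
  Put $a_j = (\alpha_j^{(1)}, \dots, \alpha_j^{(4)}) \in \mathbb{F}_2^4$. The columns of the
  matrix are the pairs $(a_j, a_{j+1})$, so its rank is the dimension of their span $W$. Read the
  sequence from left to right and record $s = \dim \langle a_1, \dots, a_j \rangle$, the excess
  $d = \dim W - s$, and whether $a_{j+1}$ lies in $S = \langle a_1, \dots, a_j \rangle$. The first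
  projection maps $W$ onto $S$, and if $a_{j+1} \in S$ then $W \subseteq S \times S$, so the
  $y$ with $(a_{j+1}, y) \in W$ form a coset of size $2^d$ inside $S$. Hence the number of
  ways to extend a sequence to any given new state depends only on the current state, and the
  state counts obey a linear recurrence in $k$, which closed forms in $2^k$ solve for $k \ge 4$.
\<close>

section \<open>Spans in groups of exponent two\<close>

text \<open>Such groups are exactly the vector spaces over the field with two elements, and their
  subgroups are the subspaces. Spans can thus be handled by addition alone, uniformly for vectors
  and for pairs of vectors.\<close>

class exp2_group = ab_group_add +
  assumes add_self: "x + x = 0"
begin

lemma add_self_left: "x + (x + y) = y"
  by (simp add: add_self flip: add.assoc)

end

instance bit :: exp2_group
  by standard (metis add_cancel_left_left bit.exhaust)

instance bit :: finite
proof
  have "(UNIV :: bit set) = {0, 1}"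
    by (auto simp: UNIV_eq_I)
  then show "finite (UNIV :: bit set)"
    by (metis finite.emptyI finite.insertI)
qed

instance prod :: (exp2_group, exp2_group) exp2_group
  by standard (simp add: plus_prod_def zero_prod_def add_self)

fun xspan :: "'a::exp2_group list \<Rightarrow> 'a set" where
  "xspan [] = {0}"
| "xspan (x # xs) = xspan xs \<union> (+) x ` xspan xs"

text \<open>A greedy dimension count: each element is tested against the span of those after it. By
  \<open>card_xspan\<close> the value depends only on the span.\<close>

fun xrank :: "'a::exp2_group list \<Rightarrow> nat" where
  "xrank [] = 0"
| "xrank (x # xs) = (if x \<in> xspan xs then xrank xs else Suc (xrank xs))"

lemma zero_in_xspan [simp]: "0 \<in> xspan xs"
  by (induction xs) auto

lemma mem_xspan_Cons: "v \<in> xspan (x # xs) \<longleftrightarrow> v \<in> xspan xs \<or> x + v \<in> xspan xs"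
proof -
  have "v \<in> (+) x ` xspan xs \<longleftrightarrow> x + v \<in> xspan xs"
    by (metis (no_types, opaque_lifting) add_self_left image_iff)
  then show ?thesis
    by simp
qed

lemma xspan_add: "u \<in> xspan xs \<Longrightarrow> v \<in> xspan xs \<Longrightarrow> u + v \<in> xspan xs"
proof (induction xs arbitrary: u v)
  case (Cons x xs)
  have "(x + u) + (x + v) = u + v"
    by (simp only: add_ac add_self add_0_left add_0_right add_self_left)
  then show ?case
    using Cons.prems Cons.IH[of u v] Cons.IH[of "x + u" v] Cons.IH[of u "x + v"]
      Cons.IH[of "x + u" "x + v"]
    unfolding mem_xspan_Cons by (metis add.assoc add.left_commute)
qed simp

lemma xspan_Cons_absorb: "x \<in> xspan xs \<Longrightarrow> xspan (x # xs) = xspan xs"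
  by (auto intro: xspan_add)

lemma set_subset_xspan: "set xs \<subseteq> xspan xs"
proof (induction xs)
  case (Cons x xs)
  have "x \<in> (+) x ` xspan xs"
    by (rule image_eqI[of _ _ 0]) simp_all
  with Cons show ?case by auto
qed simp

lemma xspan_subsetI: "set xs \<subseteq> xspan ys \<Longrightarrow> xspan xs \<subseteq> xspan ys"
  by (induction xs) (auto intro: xspan_add)

lemma finite_xspan [simp]: "finite (xspan xs)"
  by (induction xs) auto

text \<open>If \<open>x\<close> lies outside the span, the span and its translate by
  \<open>x\<close> are disjoint cosets of equal size, so the cardinality doubles; otherwise nothing
  changes.\<close>

lemma card_xspan: "card (xspan xs) = 2 ^ xrank xs"
proof (induction xs)
  case (Cons x xs)
  show ?case
  proof (cases "x \<in> xspan xs")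
    case True
    with Cons show ?thesis by (simp add: xspan_Cons_absorb del: xspan.simps)
  next
    case False
    have "xspan xs \<inter> (+) x ` xspan xs = {}"
    proof (rule ccontr)
      assume "xspan xs \<inter> (+) x ` xspan xs \<noteq> {}"
      then obtain v where "v \<in> xspan xs" "x + v \<in> xspan xs" by auto
      then have "(x + v) + v \<in> xspan xs" by (rule xspan_add[rotated])
      with False show False by (simp add: add.assoc add_self)
    qed
    moreover have "card ((+) x ` xspan xs) = card (xspan xs)"
      by (rule card_image) simp
    ultimately show ?thesis
      using Cons False by (simp add: card_Un_disjoint)
  qed
qed simp

lemma xspan_map:
  fixes f :: "'a::exp2_group \<Rightarrow> 'b::exp2_group"
  assumes add: "\<And>u v. f (u + v) = f u + f v"
  shows "xspan (map f xs) = f ` xspan xs"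
proof (induction xs)
  case Nil
  have "f 0 = 0" using add[of 0 0] by simp
  then show ?case by simp
next
  case (Cons x xs)
  then show ?case by (simp add: image_Un image_image add)
qed

text \<open>An injective additive map carries spans to spans and independent elements to independent
  ones. The elements counted by \<open>xrank\<close> therefore become a maximal independent set of
  columns. Only the set of columns enters, so order and repetition do not matter.\<close>

lemma rank_eq_xrank:
  fixes \<phi> :: "'a::exp2_group \<Rightarrow> bit vec"
  assumes add: "\<And>u v. \<phi> (u + v) = \<phi> u + \<phi> v"
    and carrier: "\<And>u. \<phi> u \<in> carrier_vec n"
    and inj: "inj \<phi>"
    and A: "A \<in> carrier_mat n nc" "set (cols A) = \<phi> ` set xs"
  shows "vec_space.rank n A = xrank xs"
proof -
  interpret V: vec_space "TYPE(bit)" n .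
  have zero: "\<phi> 0 = 0\<^sub>v n"
  proof (rule eq_vecI)
    fix i assume "i < dim_vec (0\<^sub>v n :: bit vec)"
    then show "\<phi> 0 $ i = 0\<^sub>v n $ i"
      using arg_cong[OF add[of 0 0], of "\<lambda>v. v $ i"] carrier[of 0] by (simp add: add_self)
  qed (use carrier[of 0] in auto)
  have sub: "\<phi> ` S \<subseteq> carrier_vec n" for S
    using carrier by auto
  have span: "\<phi> ` xspan ys = V.span (\<phi> ` set ys)" for ys
  proof
    show "\<phi> ` xspan ys \<subseteq> V.span (\<phi> ` set ys)"
    proof (induction ys)
      case Nil
      show ?case
        by (simp only: list.set image_empty image_insert xspan.simps zero V.span_empty subset_refl)
    next
      case (Cons y ys)
      have mono: "V.span (\<phi> ` set ys) \<subseteq> V.span (\<phi> ` set (y # ys))"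
        by (rule V.span_is_monotone) auto
      have own: "\<phi> y \<in> V.span (\<phi> ` set (y # ys))"
        using V.in_own_span[OF sub, of "set (y # ys)"] by auto
      show ?case
      proof (rule image_subsetI)
        fix w assume "w \<in> xspan (y # ys)"
        then consider "w \<in> xspan ys" | u where "u \<in> xspan ys" "w = y + u"
          by auto
        then show "\<phi> w \<in> V.span (\<phi> ` set (y # ys))"
        proof cases
          case 1
          then show ?thesis using Cons mono by blast
        next
          case 2
          then have "\<phi> u \<in> V.span (\<phi> ` set (y # ys))"
            using Cons mono by blast
          with V.span_add1[OF sub own] show ?thesis
            by (simp only: 2 add)
        qed
      qed
    qed
    \<comment> \<open>The only scalars are 0 and 1, so closure under scalars follows from containing
      zero. Being a subspace that contains the generators, the image contains their span.\<close>
    have "submodule class_ring (\<phi> ` xspan ys) V.V"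
    proof
      show "\<phi> ` xspan ys \<subseteq> carrier V.V"
        using sub by simp
      show "v \<oplus>\<^bsub>V.V\<^esub> w \<in> \<phi> ` xspan ys" if "v \<in> \<phi> ` xspan ys" "w \<in> \<phi> ` xspan ys" for v w
        using that by (auto simp: xspan_add simp flip: add)
      show "\<zero>\<^bsub>V.V\<^esub> \<in> \<phi> ` xspan ys"
        using zero by (auto intro!: image_eqI[of _ _ 0])
      show "c \<odot>\<^bsub>V.V\<^esub> v \<in> \<phi> ` xspan ys" if "v \<in> \<phi> ` xspan ys" for c v
      proof (cases "c = 0")
        case True
        have "0 \<cdot>\<^sub>v v = \<phi> 0"
          using that carrier by (auto simp: zero)
        with True show ?thesis by simp
      next
        case False
        with that show ?thesis by simp
      qed
    qed
    then show "V.span (\<phi> ` set ys) \<subseteq> \<phi> ` xspan ys"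
      by (intro V.span_is_subset image_mono set_subset_xspan)
  qed
  \<comment> \<open>The basis is built along the list: \<open>y\<close> joins it exactly when
    \<open>xrank\<close> counts it.\<close>
  have basis: "\<exists>B \<subseteq> \<phi> ` set ys. V.lin_indpt B \<and> V.span B = V.span (\<phi> ` set ys) \<and> card B = xrank ys"
    for ys
  proof (induction ys)
    case Nil
    have "V.lin_indpt {}"
      using V.lindep_span[OF empty_subsetI finite.emptyI] by blast
    then show ?case
      by (intro exI[of _ "{}"])
        (simp only: list.set image_empty card.empty xrank.simps subset_refl conj_absorb simp_thms)
  next
    case (Cons y ys)
    then obtain B where B: "B \<subseteq> \<phi> ` set ys" "V.lin_indpt B" "V.span B = V.span (\<phi> ` set ys)"
      "card B = xrank ys" by blast
    show ?case
    proof (cases "y \<in> xspan ys")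
      case True
      then have "V.span (\<phi> ` set (y # ys)) = V.span (\<phi> ` set ys)"
        by (simp only: xspan_Cons_absorb flip: span)
      then have "V.span B = V.span (\<phi> ` set (y # ys))"
        by (simp only: B(3))
      moreover have "B \<subseteq> \<phi> ` set (y # ys)" "card B = xrank (y # ys)"
        using B(1,4) True by auto
      ultimately show ?thesis
        using B(2) by blast
    next
      case False
      have BV: "B \<subseteq> carrier_vec n" using B(1) carrier by auto
      have y: "\<phi> y \<notin> V.span B"
        unfolding B(3) span[symmetric] using False inj by (simp add: inj_image_mem_iff)
      then have yB: "\<phi> y \<notin> B"
        using V.in_own_span[OF BV] by blast
      have "V.lin_indpt (insert (\<phi> y) B)"
        using V.lin_dep_iff_in_span[OF BV B(2) carrier yB] y
        unfolding Un_insert_right Un_empty_right by blast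
      moreover have "V.span (insert (\<phi> y) B) = V.span (\<phi> ` set (y # ys))"
      proof
        show "V.span (insert (\<phi> y) B) \<subseteq> V.span (\<phi> ` set (y # ys))"
          using B(1) by (intro V.span_is_monotone) auto
        have BV': "insert (\<phi> y) B \<subseteq> carrier_vec n" using BV carrier by auto
        have "\<phi> ` set ys \<subseteq> V.span (insert (\<phi> y) B)"
          using V.in_own_span[OF sub[of "set ys"]] V.span_is_monotone[of B "insert (\<phi> y) B"]
          unfolding B(3) by blast
        then have "\<phi> ` set (y # ys) \<subseteq> V.span (insert (\<phi> y) B)"
          using V.in_own_span[OF BV'] unfolding list.set image_insert by blast
        then show "V.span (\<phi> ` set (y # ys)) \<subseteq> V.span (insert (\<phi> y) B)"
          by (intro V.span_is_subset V.span_is_submodule BV')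
      qed
      moreover have "card (insert (\<phi> y) B) = xrank (y # ys)"
        using False yB B(4) finite_subset[OF B(1)] by simp
      moreover have "insert (\<phi> y) B \<subseteq> \<phi> ` set (y # ys)"
        using B(1) by auto
      ultimately show ?thesis
        by blast
    qed
  qed
  obtain B where B: "B \<subseteq> \<phi> ` set xs" "V.lin_indpt B" "V.span B = V.span (\<phi> ` set xs)"
      "card B = xrank xs"
    using basis[of xs] by blast
  have BV: "B \<subseteq> carrier_vec n" using B(1) carrier by auto
  \<comment> \<open>Any further column lies in the span of \<open>B\<close>, so adjoining it would
    create a dependence.\<close>
  have "maximal B (\<lambda>T. T \<subseteq> set (cols A) \<and> V.lin_indpt T)"
    unfolding maximal_def
  proof (intro conjI allI impI)
    fix T assume T: "B \<subseteq> T \<and> T \<subseteq> set (cols A) \<and> V.lin_indpt T"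
    show "T = B"
    proof (rule ccontr)
      assume "T \<noteq> B"
      then obtain t where t: "t \<in> T" "t \<notin> B" using T by auto
      then have "t \<in> V.span B"
        using T V.in_own_span[OF sub[of "set xs"]] unfolding A(2) B(3) by blast
      moreover have "t \<in> carrier_vec n" using t(1) T sub[of "set xs"] unfolding A(2) by blast
      ultimately have "V.lin_dep (B \<union> {t})"
        using V.lin_dep_iff_in_span[OF BV B(2) _ t(2)] by blast
      moreover have "V.lin_indpt (B \<union> {t})"
        using T t V.subset_li_is_li[of T "B \<union> {t}"] by blast
      ultimately show False by blast
    qed
  qed (use B(1,2) in \<open>unfold A(2), blast+\<close>)
  then show ?thesis
    using V.rank_card_indpt[OF A(1)] B(4) by simp
qed

section \<open>Transitions between states\<close>

text \<open>Sequences are stored with the most recent vector first.\<close>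

fun steps :: "'a list \<Rightarrow> ('a \<times> 'a) list" where
  "steps (x # y # xs) = (y, x) # steps (y # xs)"
| "steps _ = []"

section \<open>Projections of the column span and their fibres\<close>

lemma map_fst_steps: "map fst (steps (x # xs)) = xs"
  by (induction xs arbitrary: x) auto

text \<open>The oldest vector stands last and has no predecessor, so its position is the only one
  that is never a second component.\<close>

lemma map_snd_steps: "map snd (steps (x # xs)) = butlast (x # xs)"
  by (induction xs arbitrary: x) auto

lemma fst_xspan_steps:
  fixes x :: "'a::exp2_group"
  shows "fst ` xspan (steps (x # xs)) = xspan xs"
proof -
  have "xspan (map fst (steps (x # xs))) = fst ` xspan (steps (x # xs))"
    by (rule xspan_map) simp
  then show ?thesis by (simp add: map_fst_steps)
qed

lemma snd_xspan_steps_subset: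
  fixes x :: "'a::exp2_group"
  shows "snd ` xspan (steps (x # xs)) \<subseteq> xspan (x # xs)"
proof -
  have "xspan (map snd (steps (x # xs))) = snd ` xspan (steps (x # xs))"
    by (rule xspan_map) simp
  moreover have "xspan (butlast (x # xs)) \<subseteq> xspan (x # xs)"
    using set_subset_xspan[of "x # xs"] by (intro xspan_subsetI) (meson in_set_butlastD subset_iff)
  ultimately show ?thesis by (simp add: map_snd_steps del: xspan.simps butlast.simps)
qed

text \<open>Pick \<open>(u, y)\<close> and \<open>(v, z)\<close> in the span; translation by
  \<open>y + z\<close> maps the fibre over \<open>u\<close> into the fibre over \<open>v\<close>.
  Exchanging \<open>u\<close> and \<open>v\<close> then gives equality.\<close>

lemma card_fibre_le:
  assumes "u \<in> fst ` xspan ps" "v \<in> fst ` xspan ps"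
  shows "card {y. (u, y) \<in> xspan ps} \<le> card {y. (v, y) \<in> xspan ps}"
proof -
  obtain y z where yz: "(u, y) \<in> xspan ps" "(v, z) \<in> xspan ps"
    using assms by auto
  have "(v, (y + z) + t) \<in> xspan ps" if "(u, t) \<in> xspan ps" for t
  proof -
    have "u + v + u = v"
      by (metis add.commute add_self_left)
    then show ?thesis
      using xspan_add[OF xspan_add[OF yz] that] by (metis add_Pair)
  qed
  then have "(+) (y + z) ` {y. (u, y) \<in> xspan ps} \<subseteq> {y. (v, y) \<in> xspan ps}"
    by auto
  moreover have "finite {y. (v, y) \<in> xspan ps}"
    by (rule finite_subset[of _ "snd ` xspan ps"]) force+
  ultimately have "card ((+) (y + z) ` {y. (u, y) \<in> xspan ps}) \<le> card {y. (v, y) \<in> xspan ps}"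
    by (intro card_mono)
  then show ?thesis by (simp add: card_image)
qed

text \<open>The column span is the disjoint union of equally large fibres over its first projection
  \<open>xspan xs\<close>. The product form avoids a quotient of powers.\<close>

lemma card_fibre:
  fixes x :: "'a::exp2_group"
  assumes "u \<in> xspan xs"
  shows "card {y. (u, y) \<in> xspan (steps (x # xs))} * 2 ^ xrank xs = 2 ^ xrank (steps (x # xs))"
proof -
  let ?W = "xspan (steps (x # xs))"
  have W: "?W = (SIGMA v : xspan xs. {y. (v, y) \<in> ?W})"
    using fst_xspan_steps[of x xs] by force
  have "card {y. (v, y) \<in> ?W} = card {y. (u, y) \<in> ?W}" if "v \<in> xspan xs" for v
    using that assms by (intro antisym card_fibre_le) (simp_all only: fst_xspan_steps)
  moreover have "finite {y. (v, y) \<in> ?W}" for v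
    by (rule finite_subset[of _ "snd ` ?W"]) force+
  ultimately have "card (SIGMA v : xspan xs. {y. (v, y) \<in> ?W}) = card (xspan xs) * card {y. (u, y) \<in> ?W}"
    by (subst card_SigmaI) simp_all
  with W have "card ?W = card (xspan xs) * card {y. (u, y) \<in> ?W}" by simp
  then show ?thesis by (simp add: card_xspan mult.commute)
qed

text \<open>By \<open>card_fibre\<close> one power of two divides the other. This makes the excess
  \<open>d\<close> a natural number obtained without truncated subtraction.\<close>

lemma xrank_le_xrank_steps:
  fixes x :: "'a::exp2_group"
  shows "xrank xs \<le> xrank (steps (x # xs))"
proof -
  have "(2::nat) ^ xrank xs dvd 2 ^ xrank (steps (x # xs))"
    using card_fibre[OF zero_in_xspan[of xs], of x] by (metis dvd_triv_right)
  then show ?thesis by (simp add: dvd_power_iff_le)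
qed

section \<open>State counts and their linear recurrence\<close>

type_synonym bit4 = "bit \<times> bit \<times> bit \<times> bit"

lemma card_bit4: "card (UNIV :: bit4 set) = 16"
proof -
  have "(UNIV :: bit set) = {0, 1}"
    by (auto simp: UNIV_eq_I)
  then have "card (UNIV :: bit set) = card {0, 1 :: bit}"
    by metis
  then show ?thesis
    by (simp add: UNIV_Times_UNIV[symmetric] card_cartesian_product del: UNIV_Times_UNIV)
qed

text \<open>The newest vector \<open>hd b\<close> is not yet the first component of any column, so
  \<open>s\<close> is measured without it and its position relative to that span is kept as the flag
  \<open>f\<close>.\<close>

definition in_state :: "nat \<Rightarrow> nat \<Rightarrow> bool \<Rightarrow> 'a::exp2_group list \<Rightarrow> bool" where
  "in_state s d f b \<longleftrightarrow>
     xrank (tl b) = s \<and> xrank (steps b) = s + d \<and> (hd b \<in> xspan (tl b)) = f"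

text \<open>Integer values accommodate the subtractions in the recurrence, and a sum of indicators
  lets it be derived by linearity.\<close>

definition state_count :: "nat \<Rightarrow> nat \<Rightarrow> nat \<Rightarrow> bool \<Rightarrow> int" where
  "state_count k s d f = (\<Sum>b | length b = Suc k. of_bool (in_state s d f (b :: bit4 list)))"

lemma finite_length: "finite {b :: 'a::finite list. length b = n}"
  using finite_lists_length_eq[of "UNIV :: 'a set" n] by simp

lemma sum_lists_length_Suc:
  fixes g :: "'a::finite list \<Rightarrow> 'b::comm_monoid_add"
  shows "(\<Sum>b | length b = Suc n. g b) = (\<Sum>b | length b = n. \<Sum>y\<in>UNIV. g (y # b))"
proof -
  have "{b :: 'a list. length b = Suc n} = (\<lambda>(b, y). y # b) ` ({b. length b = n} \<times> UNIV)"
    by (force simp: length_Suc_conv image_iff)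
  moreover have "inj_on (\<lambda>(b, y). y # b) ({b :: 'a list. length b = n} \<times> UNIV)"
    by (auto simp: inj_on_def)
  ultimately have "(\<Sum>b | length b = Suc n. g b)
      = (\<Sum>(b, y) \<in> {b. length b = n} \<times> UNIV. g (y # b))"
    by (simp add: sum.reindex case_prod_unfold)
  then show ?thesis
    by (simp add: sum.cartesian_product)
qed

text \<open>These \<open>y\<close> form a fibre of the column span, of size \<open>2 ^ d\<close> by
  \<open>card_fibre\<close>. They stay inside \<open>xspan xs\<close> because adjoining
  \<open>x\<close> does not enlarge that span.\<close>

lemma card_next_inside:
  fixes x :: "'a::exp2_group"
  assumes "x \<in> xspan xs" "xrank xs = s" "xrank (steps (x # xs)) = s + d"
  shows "card {y. (x, y) \<in> xspan (steps (x # xs))} = 2 ^ d"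
    and "{y. (x, y) \<in> xspan (steps (x # xs))} \<subseteq> xspan xs"
proof -
  show "card {y. (x, y) \<in> xspan (steps (x # xs))} = 2 ^ d"
    using card_fibre[OF assms(1), of x] assms(2,3) by (simp add: power_add)
  show "{y. (x, y) \<in> xspan (steps (x # xs))} \<subseteq> xspan xs"
    using snd_xspan_steps_subset[of x xs] unfolding xspan_Cons_absorb[OF assms(1)] by force
qed

text \<open>The three terms are the possible predecessors. From flag \<open>True\<close>, a
  \<open>y\<close> in the fibre over the newest vector keeps \<open>d\<close>, and any other
  \<open>y\<close> in the span raises \<open>d\<close> by one. From flag \<open>False\<close>, the
  newest vector enlarges the span, so \<open>s\<close> grows and all \<open>2 ^ s\<close> elements
  of the new span qualify.\<close>

lemma card_next_True:
  fixes b :: "bit4 list"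
  assumes "b \<noteq> []"
  shows "int (card {y. in_state s d True (y # b)}) =
     2 ^ d * of_bool (in_state s d True b)
     + (if d = 0 then 0 else (2 ^ s - 2 ^ (d - 1)) * of_bool (in_state s (d - 1) True b))
     + (if s = 0 then 0 else 2 ^ s * of_bool (in_state (s - 1) d False b))"
proof -
  obtain x xs where b: "b = x # xs" using assms by (cases b) auto
  let ?F = "{y. (x, y) \<in> xspan (steps (x # xs))}"
  define d0 where "d0 = xrank (steps (x # xs)) - xrank xs"
  have r: "xrank (steps (x # xs)) = xrank xs + d0"
    using xrank_le_xrank_steps[of xs x] by (simp add: d0_def)
  show ?thesis
  proof (cases "x \<in> xspan xs")
    case True
    note F = card_next_inside[OF True refl r]
    have next_eq: "{y. in_state s d True (y # b)} =
        (if xrank xs = s \<and> d0 = d then ?F else if xrank xs = s \<and> Suc d0 = d then xspan xs - ?F else {})"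
      using True F(2) by (auto simp: in_state_def b r xspan_Cons_absorb simp del: xspan.simps)
    have "int (card (xspan xs - ?F)) = 2 ^ xrank xs - 2 ^ d0"
      using F card_mono[OF finite_xspan F(2)]
      by (simp add: card_Diff_subset finite_subset[OF F(2) finite_xspan] card_xspan of_nat_diff)
    then show ?thesis
      unfolding next_eq using True F(1) by (auto simp: in_state_def b r)
  next
    case False
    \<comment> \<open>First components of the column span lie in \<open>xspan xs\<close>. Hence
      every \<open>y\<close> gives an independent column, so \<open>s\<close> and the rank both grow
      by one while \<open>d\<close> stays.\<close>
    then have "(x, y) \<notin> xspan (steps (x # xs))" for y
      using fst_xspan_steps[of x xs] by force
    then have next_eq: "{y. in_state s d True (y # b)} =
        (if Suc (xrank xs) = s \<and> d0 = d then xspan (x # xs) else {})"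
      using False by (auto simp: in_state_def b r simp del: xspan.simps)
    show ?thesis
      unfolding next_eq using False card_xspan[of "x # xs"]
      by (cases s) (auto simp: in_state_def b r simp del: xspan.simps)
  qed
qed

text \<open>A \<open>y\<close> outside the span of its predecessors avoids the fibre over the newest
  vector, so the column rank always grows. The growth goes into \<open>d\<close> if the newest
  vector was inside the old span, and into \<open>s\<close> if it was outside.\<close>

lemma card_next_False:
  fixes b :: "bit4 list"
  assumes "b \<noteq> []"
  shows "int (card {y. in_state s d False (y # b)}) =
     (16 - 2 ^ s) * ((if d = 0 then 0 else of_bool (in_state s (d - 1) True b))
     + (if s = 0 then 0 else of_bool (in_state (s - 1) d False b)))"
proof -
  obtain x xs where b: "b = x # xs" using assms by (cases b) auto
  define d0 where "d0 = xrank (steps (x # xs)) - xrank xs"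
  have r: "xrank (steps (x # xs)) = xrank xs + d0"
    using xrank_le_xrank_steps[of xs x] by (simp add: d0_def)
  have compl: "int (card (- xspan ys)) = 16 - 2 ^ xrank ys" for ys :: "bit4 list"
    using card_mono[OF finite_UNIV, of "xspan ys"]
    by (simp add: Compl_eq_Diff_UNIV card_Diff_subset card_bit4 card_xspan of_nat_diff)
  show ?thesis
  proof (cases "x \<in> xspan xs")
    case True
    have next_eq: "{y. in_state s d False (y # b)} =
        (if xrank xs = s \<and> Suc d0 = d then - xspan xs else {})"
      using True card_next_inside(2)[OF True refl r]
      by (auto simp: in_state_def b r xspan_Cons_absorb simp del: xspan.simps)
    show ?thesis
      unfolding next_eq using True compl[of xs] by (auto simp: in_state_def b r)
  next
    case False
    then have "(x, y) \<notin> xspan (steps (x # xs))" for y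
      using fst_xspan_steps[of x xs] by force
    then have next_eq: "{y. in_state s d False (y # b)} =
        (if Suc (xrank xs) = s \<and> d0 = d then - xspan (x # xs) else {})"
      using False by (auto simp: in_state_def b r simp del: xspan.simps)
    show ?thesis
      unfolding next_eq using False compl[of "x # xs"]
      by (cases s) (auto simp: in_state_def b r simp del: xspan.simps)
  qed
qed

lemma state_count_Suc:
  "state_count (Suc k) s d f =
     (\<Sum>b | length b = Suc k. int (card {y :: bit4. in_state s d f (y # b)}))"
  unfolding state_count_def sum_lists_length_Suc[of _ "Suc k"]
  by simp

lemma state_count_Suc_True:
  "state_count (Suc k) s d True = 2 ^ d * state_count k s d True
     + (if d = 0 then 0 else (2 ^ s - 2 ^ (d - 1)) * state_count k s (d - 1) True)
     + (if s = 0 then 0 else 2 ^ s * state_count k (s - 1) d False)"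
proof -
  have "state_count (Suc k) s d True = (\<Sum>b :: bit4 list | length b = Suc k.
      2 ^ d * of_bool (in_state s d True b)
     + (if d = 0 then 0 else (2 ^ s - 2 ^ (d - 1)) * of_bool (in_state s (d - 1) True b))
     + (if s = 0 then 0 else 2 ^ s * of_bool (in_state (s - 1) d False b)))"
    unfolding state_count_Suc by (intro sum.cong refl card_next_True) auto
  then show ?thesis
    by (simp add: state_count_def sum.distrib sum_distrib_left del: sum_of_bool_eq)
qed

lemma state_count_Suc_False:
  "state_count (Suc k) s d False =
     (16 - 2 ^ s) * ((if d = 0 then 0 else state_count k s (d - 1) True)
     + (if s = 0 then 0 else state_count k (s - 1) d False))"
proof -
  have "state_count (Suc k) s d False = (\<Sum>b :: bit4 list | length b = Suc k.
     (16 - 2 ^ s) * ((if d = 0 then 0 else of_bool (in_state s (d - 1) True b))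
     + (if s = 0 then 0 else of_bool (in_state (s - 1) d False b))))"
    unfolding state_count_Suc by (intro sum.cong refl card_next_False) auto
  then show ?thesis
    by (simp add: state_count_def sum.distrib del: sum_of_bool_eq flip: sum_distrib_left)
qed

section \<open>Initial values and closed forms\<close>

lemma state_count_0:
  "state_count 0 s d f = (if s = 0 \<and> d = 0 then if f then 1 else 15 else 0)"
proof -
  have "state_count 0 s d f = int (card {y :: bit4. in_state s d f [y]})"
    unfolding state_count_def sum_lists_length_Suc by simp
  \<comment> \<open>A single vector produces no column, so \<open>s = d = 0\<close>, and only the
    zero vector lies in the trivial span.\<close>
  also have "{y :: bit4. in_state s d f [y]} =
      (if s = 0 \<and> d = 0 then if f then {0} else - {0} else {})"
    by (auto simp: in_state_def)
  finally show ?thesis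
    by (auto simp: Compl_eq_Diff_UNIV card_Diff_subset card_bit4)
qed

text \<open>With flag \<open>True\<close> the column span lies in S x S, whence
  \<open>d \<le> s\<close>; an outside newest vector allows one more dimension. The two bounds are
  proved together because the recurrences refer to each other.\<close>

lemma state_count_vanish:
  shows "d > s \<Longrightarrow> state_count k s d True = 0"
    and "d > Suc s \<Longrightarrow> state_count k s d False = 0"
proof (induction k arbitrary: s d)
  case 0
  { case 1 then show ?case by (simp add: state_count_0) }
  { case 2 then show ?case by (simp add: state_count_0) }
next
  case (Suc k)
  { case 1
    \<comment> \<open>In the boundary case \<open>d = Suc s\<close> the count for
      \<open>d - 1\<close> need not vanish, but its coefficient \<open>2 ^ s - 2 ^ (d - 1)\<close>
      does.\<close>
    then show ?case
      using Suc.IH(1)[of s d] Suc.IH(1)[of s "d - 1"] Suc.IH(2)[of "s - 1" d]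
      by (cases "d = Suc s") (auto simp: state_count_Suc_True) }
  { case 2
    then show ?case
      using Suc.IH(1)[of s "d - 1"] Suc.IH(2)[of "s - 1" d]
      by (auto simp: state_count_Suc_False) }
qed

text \<open>
  The counts factor because $P_{s,d}(x) = \prod_{j<d} (x - 2^{s+j})$ satisfies
  $P_{s,d}(2x) - 2^d P_{s,d}(x) = 2^{s+d-1} (2^d - 1) P_{s,d-1}(x)$.
\<close>

lemma state_count_closed:
  assumes "k \<ge> 4"
  shows "state_count k 0 0 True = 1
    \<and> state_count k 1 0 True = 30
    \<and> state_count k 1 1 True = 30 * (2 ^ k - 2)
    \<and> state_count k 2 0 True = 840
    \<and> state_count k 2 1 True = 1260 * (2 ^ k - 4)
    \<and> state_count k 2 2 True = 140 * (2 ^ k - 4) * (2 ^ k - 8)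
    \<and> state_count k 3 0 True = 20160
    \<and> state_count k 3 1 True = 35280 * (2 ^ k - 8)
    \<and> state_count k 3 2 True = 5880 * (2 ^ k - 8) * (2 ^ k - 16)
    \<and> state_count k 3 3 True = 120 * (2 ^ k - 8) * (2 ^ k - 16) * (2 ^ k - 32)
    \<and> state_count k 4 0 True = 322560
    \<and> state_count k 4 1 True = 604800 * (2 ^ k - 16)
    \<and> state_count k 4 2 True = 117600 * (2 ^ k - 16) * (2 ^ k - 32)
    \<and> state_count k 4 3 True = 3600 * (2 ^ k - 16) * (2 ^ k - 32) * (2 ^ k - 64)
    \<and> state_count k 4 4 True = 16 * (2 ^ k - 16) * (2 ^ k - 32) * (2 ^ k - 64) * (2 ^ k - 128)
    \<and> state_count k 0 0 False = 0
    \<and> state_count k 0 1 False = 15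
    \<and> state_count k 1 0 False = 0
    \<and> state_count k 1 1 False = 630
    \<and> state_count k 1 2 False = 210 * (2 ^ k - 4)
    \<and> state_count k 2 0 False = 0
    \<and> state_count k 2 1 False = 17640
    \<and> state_count k 2 2 False = 8820 * (2 ^ k - 8)
    \<and> state_count k 2 3 False = 420 * (2 ^ k - 8) * (2 ^ k - 16)
    \<and> state_count k 3 0 False = 0
    \<and> state_count k 3 1 False = 302400
    \<and> state_count k 3 2 False = 176400 * (2 ^ k - 16)
    \<and> state_count k 3 3 False = 12600 * (2 ^ k - 16) * (2 ^ k - 32)
    \<and> state_count k 3 4 False = 120 * (2 ^ k - 16) * (2 ^ k - 32) * (2 ^ k - 64)"
  using assms
proof (induction k rule: dec_induct)
  case base
  \<comment> \<open>The counts for \<open>d = 0\<close> and flag \<open>False\<close> come from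
    sequences of independent vectors and vanish unless \<open>s = k\<close>. The factor
    \<open>16 - 2 ^ s\<close> ends this transient at \<open>s = 4\<close>, which is why the closed
    forms start at \<open>k = 4\<close>.\<close>
  have four: "state_count 4 = state_count (Suc (Suc (Suc (Suc 0))))"
    by (simp add: numeral_eq_Suc)
  show ?case
    unfolding four
    by (simp add: state_count_Suc_True state_count_Suc_False state_count_0)
next
  case (step k)
  define x :: int where "x = 2 ^ k"
  \<comment> \<open>Zero values bordering the table; for instance, the recurrence for state
    \<open>(1, 2, False)\<close> refers to \<open>(0, 2, False)\<close>.\<close>
  have v: "state_count k 0 1 True = 0" "state_count k 1 2 True = 0"
    "state_count k 2 3 True = 0" "state_count k 3 4 True = 0"
    "state_count k 0 2 False = 0" "state_count k 1 3 False = 0" "state_count k 2 4 False = 0"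
    by (simp_all add: state_count_vanish)
  note IH = step.IH[folded x_def, unfolded One_nat_def] v[unfolded One_nat_def]
  have x: "2 ^ Suc k = 2 * x" by (simp add: x_def)
  show ?case
    unfolding x state_count_Suc_True state_count_Suc_False
    by (intro conjI; simp add: IH; simp add: algebra_simps)
qed

section \<open>Matrices as sequences\<close>

text \<open>Every index other than 1, 2, 3 reads the fourth coordinate, so \<open>entry m\<close> is
  additive for all \<open>m\<close>.\<close>

fun entry :: "nat \<Rightarrow> bit4 \<Rightarrow> bit" where
  "entry m (a, b, c, d) = (if m = 1 then a else if m = 2 then b else if m = 3 then c else d)"

lemma entry_add: "entry m (u + v) = entry m u + entry m v"
  by (cases u; cases v) simp

lemma entry_eqI:
  assumes "\<And>m. m \<in> {1..4} \<Longrightarrow> entry m u = entry m v"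
  shows "u = v"
  using assms[of 1] assms[of 2] assms[of 3] assms[of 4] by (cases u; cases v) simp

text \<open>Interleaves the two vectors as the two rows of each block; this is the injective
  additive map to which \<open>rank_eq_xrank\<close> is applied.\<close>

definition column :: "bit4 \<times> bit4 \<Rightarrow> bit vec" where
  "column p = vec 8 (\<lambda>r. entry (r div 2 + 1) (if r mod 2 = 0 then fst p else snd p))"

lemma column_add: "column (p + q) = column p + column q"
  by (rule eq_vecI) (auto simp: column_def entry_add)

lemma inj_column: "inj column"
proof (rule injI)
  fix p q assume eq: "column p = column q"
  have ent: "entry (r div 2 + 1) (if r mod 2 = 0 then fst p else snd p)
      = entry (r div 2 + 1) (if r mod 2 = 0 then fst q else snd q)" if "r < 8" for r
    using arg_cong[OF eq, of "\<lambda>v. v $ r"] that by (simp add: column_def)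
  have "entry m (fst p) = entry m (fst q)" "entry m (snd p) = entry m (snd q)"
    if "m \<in> {1..4}" for m
  proof -
    have "(2 * (m - 1) + 1) div 2 = m - 1" "(2 * (m - 1) + 1) mod 2 = 1" by presburger+
    with that show "entry m (fst p) = entry m (fst q)" "entry m (snd p) = entry m (snd q)"
      using ent[of "2 * (m - 1)"] ent[of "2 * (m - 1) + 1"] by auto
  qed
  then show "p = q"
    by (intro prod_eqI entry_eqI)
qed

text \<open>The list has length \<open>k + 1\<close> with the newest vector first, so index
  \<open>j\<close>, counted from 1, sits at position \<open>k + 1 - j\<close>.\<close>

definition seq_mat :: "nat \<Rightarrow> bit4 list \<Rightarrow> bit mat" where
  "seq_mat k b = quad_persym_mat k (\<lambda>m j. entry m (b ! (k + 1 - j)))"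

lemma length_steps: "length (steps b) = length b - 1"
  by (induction b rule: steps.induct) auto

lemma nth_steps: "i + 1 < length b \<Longrightarrow> steps b ! i = (b ! (i + 1), b ! i)"
  by (induction b arbitrary: i rule: steps.induct) (auto simp: nth_Cons split: nat.splits)

text \<open>Column \<open>c\<close> comes from step \<open>k - 1 - c\<close>: the two orders are
  reversed, so they are compared as sets.\<close>

lemma set_cols_seq_mat:
  assumes "length b = Suc k"
  shows "set (cols (seq_mat k b)) = column ` set (steps b)"
proof -
  have col: "col (seq_mat k b) c = column (steps b ! (k - 1 - c))" if "c < k" for c
  proof (rule eq_vecI)
    fix r assume "r < dim_vec (column (steps b ! (k - 1 - c)))"
    then have r: "r < 8" by (simp add: column_def)
    have "steps b ! (k - 1 - c) = (b ! (k - c), b ! (k - 1 - c))"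
      using that assms by (subst nth_steps) (auto simp: Suc_diff_Suc)
    with r that show "col (seq_mat k b) c $ r = column (steps b ! (k - 1 - c)) $ r"
      by (auto simp: seq_mat_def quad_persym_mat_def column_def)
  qed (simp add: seq_mat_def quad_persym_mat_def column_def)
  have "set (cols (seq_mat k b)) = (\<lambda>c. column (steps b ! (k - 1 - c))) ` {..<k}"
    using col by (auto simp: cols_def seq_mat_def[symmetric] image_iff)
      (auto simp: seq_mat_def quad_persym_mat_def)
  also have "\<dots> = (\<lambda>i. column (steps b ! i)) ` (\<lambda>c. k - 1 - c) ` {..<k}"
    by (simp add: image_image)
  also have "(\<lambda>c. k - 1 - c) ` {..<k} = {..<k}"
  proof
    show "{..<k} \<subseteq> (\<lambda>c. k - 1 - c) ` {..<k}"
    proof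
      fix i assume "i \<in> {..<k}"
      then show "i \<in> (\<lambda>c. k - 1 - c) ` {..<k}"
        by (intro image_eqI[of _ _ "k - 1 - i"]) auto
    qed
  qed auto
  also have "(\<lambda>i. column (steps b ! i)) ` {..<k} = column ` set (steps b)"
    using assms by (force simp: set_conv_nth length_steps)
  finally show ?thesis .
qed

lemma rank_seq_mat:
  assumes "length b = Suc k"
  shows "vec_space.rank 8 (seq_mat k b) = xrank (steps b)"
  by (rule rank_eq_xrank[where \<phi> = column and nc = k])
    (simp_all add: column_add inj_column set_cols_seq_mat[OF assms],
      simp_all add: column_def seq_mat_def quad_persym_mat_def)

lemma bij_betw_seq_mat:
  assumes "k \<ge> 1"
  shows "bij_betw (seq_mat k) {b. length b = Suc k} (quad_persym_mats k)"
  unfolding bij_betw_def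
proof
  \<comment> \<open>The matrix sees only the indices kept by \<open>P b\<close>, and on such
    restricted families \<open>quad_persym_mat_bij\<close> provides injectivity.\<close>
  define P where
    "P b = (\<lambda>m\<in>{1..4}. \<lambda>j\<in>{1..k+1}. entry m (b ! (k + 1 - j)))" for b :: "bit4 list"
  have seq: "seq_mat k b = quad_persym_mat k (P b)" for b
    unfolding seq_mat_def quad_persym_mat_def P_def by (rule eq_matI) auto
  have P: "P b \<in> {1..4} \<rightarrow>\<^sub>E ({1..k+1} \<rightarrow>\<^sub>E UNIV)" for b
    by (auto simp: P_def)
  show "inj_on (seq_mat k) {b. length b = Suc k}"
  proof (rule inj_onI)
    fix b c assume len: "b \<in> {b. length b = Suc k}" "c \<in> {b. length b = Suc k}"
      and "seq_mat k b = seq_mat k c"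
    then have eq: "P b = P c"
      using quad_persym_mat_bij[OF assms] P unfolding bij_betw_def seq by (meson inj_onD)
    show "b = c"
    proof (rule nth_equalityI)
      fix i assume i: "i < length b"
      show "b ! i = c ! i"
      proof (rule entry_eqI)
        fix m :: nat assume "m \<in> {1..4}"
        moreover have "k + 1 - i \<in> {1..k+1}" "k + 1 - (k + 1 - i) = i"
          using i len by auto
        ultimately show "entry m (b ! i) = entry m (c ! i)"
          using fun_cong[OF fun_cong[OF eq], of m "k + 1 - i"] by (simp only: P_def restrict_apply if_True)
      qed
    qed (use len in simp)
  qed
  show "seq_mat k ` {b. length b = Suc k} = quad_persym_mats k"
  proof
    show "quad_persym_mats k \<subseteq> seq_mat k ` {b. length b = Suc k}"
    proof
      fix A assume "A \<in> quad_persym_mats k"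
      then obtain \<alpha> where A: "A = quad_persym_mat k \<alpha>" by (auto simp: quad_persym_mats_def)
      define b where "b = map (\<lambda>i. let j = k + 1 - i in (\<alpha> 1 j, \<alpha> 2 j, \<alpha> 3 j, \<alpha> 4 j)) [0..<Suc k]"
      have ent: "entry m (b ! (k + 1 - j)) = \<alpha> m j" if "m \<in> {1..4}" "j \<in> {1..k+1}" for m j
      proof -
        have "m = 1 \<or> m = 2 \<or> m = 3 \<or> m = 4" using that by auto
        then show ?thesis
          using that by (auto simp: b_def Let_def simp del: upt_Suc)
      qed
      have "seq_mat k b = A"
        unfolding A seq_mat_def quad_persym_mat_def
      proof (rule cong_mat[OF refl refl], unfold prod.case)
        fix r c :: nat assume "r < 8" "c < k"
        moreover have "r mod 2 < 2" by simp
        ultimately have "r div 2 + 1 \<in> {1..4}" "r mod 2 + c + 1 \<in> {1..k+1}"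
          unfolding atLeastAtMost_iff by linarith+
        then show "entry (r div 2 + 1) (b ! (k + 1 - (r mod 2 + c + 1)))
            = \<alpha> (r div 2 + 1) (r mod 2 + c + 1)"
          by (rule ent)
      qed
      moreover have "length b = Suc k" by (simp add: b_def)
      ultimately show "A \<in> seq_mat k ` {b. length b = Suc k}" by blast
    qed
  qed (auto simp: seq_mat_def quad_persym_mats_def)
qed

section \<open>Rank counts as sums of state counts\<close>

lemma Gamma4_eq_card:
  assumes "k \<ge> 1"
  shows "Gamma4 i k = card {b :: bit4 list. length b = Suc k \<and> xrank (steps b) = i}"
proof -
  have "{A \<in> quad_persym_mats k. vec_space.rank 8 A = i}
      = seq_mat k ` {b. length b = Suc k \<and> xrank (steps b) = i}"
    unfolding bij_betw_imp_surj_on[OF bij_betw_seq_mat[OF assms], symmetric]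
    by (auto simp: rank_seq_mat)
  moreover have "inj_on (seq_mat k) {b. length b = Suc k \<and> xrank (steps b) = i}"
    using bij_betw_seq_mat[OF assms] by (auto simp: bij_betw_def inj_on_def)
  ultimately show ?thesis
    unfolding Gamma4_def by (simp add: card_image)
qed

lemma xrank_bit4_le: "xrank (xs :: bit4 list) \<le> 4"
proof -
  have "(2::nat) ^ xrank xs \<le> 2 ^ 4"
    using card_mono[OF finite_UNIV, of "xspan xs"] by (simp add: card_xspan card_bit4)
  then show ?thesis by (simp only: power_increasing_iff)
qed

text \<open>A sequence of rank \<open>i\<close> has exactly one \<open>s\<close>, at most 4, and one
  flag, and then \<open>d = i - s\<close>. The guard \<open>s \<le> i\<close> keeps this subtraction
  from truncating.\<close>

lemma Gamma4_eq_sum_state_count: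
  assumes "k \<ge> 1"
  shows "int (Gamma4 i k) =
    (\<Sum>s\<le>4. if s \<le> i then state_count k s (i - s) True + state_count k s (i - s) False else 0)"
proof -
  have "int (Gamma4 i k) = (\<Sum>b :: bit4 list | length b = Suc k. of_bool (xrank (steps b) = i))"
    unfolding Gamma4_eq_card[OF assms] by (simp add: finite_length Collect_conj_eq)
  also have "\<dots> = (\<Sum>b :: bit4 list | length b = Suc k. \<Sum>s\<le>4.
      if s \<le> i then of_bool (in_state s (i - s) True b) + of_bool (in_state s (i - s) False b) else 0)"
  proof (rule sum.cong[OF refl])
    fix b :: "bit4 list" assume "b \<in> {b. length b = Suc k}"
    then obtain x xs where b: "b = x # xs" by (cases b) auto
    have "(\<Sum>s\<le>4. if s \<le> i then of_bool (in_state s (i - s) True b)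
        + of_bool (in_state s (i - s) False b) else 0)
      = (\<Sum>s\<le>4. if s = xrank xs then of_bool (xrank (steps b) = i) else (0 :: int))"
      using xrank_le_xrank_steps[of xs x]
      by (intro sum.cong refl) (auto simp: in_state_def b)
    also have "\<dots> = of_bool (xrank (steps b) = i)"
      using xrank_bit4_le[of xs] by (subst sum.delta) auto
    finally show "of_bool (xrank (steps b) = i) = (\<Sum>s\<le>4. if s \<le> i then
        of_bool (in_state s (i - s) True b) + of_bool (in_state s (i - s) False b) else (0 :: int))" ..
  qed
  also have "\<dots> = (\<Sum>s\<le>4. if s \<le> i then state_count k s (i - s) True + state_count k s (i - s) False else 0)"
    unfolding state_count_def
    by (subst sum.swap) (auto intro!: sum.cong simp: sum.distrib simp del: sum_of_bool_eq)
  finally show ?thesis .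
qed

text \<open>Four independent vectors span the whole space and leave nothing outside: the factor
  \<open>16 - 2 ^ 4\<close> is zero.\<close>

lemma state_count_4_False:
  assumes "k \<ge> 1"
  shows "state_count k 4 d False = 0"
  using assms by (cases k) (simp_all add: state_count_Suc_False)

theorem theorem5p2:
  fixes k :: nat
  assumes "k \<ge> 4"
  shows "int (Gamma4 0 k) = 1
    \<and> int (Gamma4 1 k) = 45
    \<and> int (Gamma4 2 k) = 30 * 2 ^ k + 1410
    \<and> int (Gamma4 3 k) = 1470 * 2 ^ k + 31920
    \<and> int (Gamma4 4 k) = 140 * 2 ^ (2 * k) + 42420 * 2 ^ k + 276640
    \<and> int (Gamma4 5 k) = 6300 * 2 ^ (2 * k) + 630000 * 2 ^ k - 11692800
    \<and> int (Gamma4 6 k) = 120 * 2 ^ (3 * k) + 123480 * 2 ^ (2 * k) - 6142080 * 2 ^ k + 66170880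
    \<and> int (Gamma4 7 k) = 3720 * 2 ^ (3 * k) - 416640 * 2 ^ (2 * k) + 13332480 * 2 ^ k - 121896960
    \<and> int (Gamma4 8 k) = 16 * 2 ^ (4 * k) - 3840 * 2 ^ (3 * k) + 286720 * 2 ^ (2 * k)
        - 7864320 * 2 ^ k + 2 ^ 26"
proof -
  define x :: int where "x = 2 ^ k"
  have x: "2 ^ (c * k) = x ^ c" for c
    by (simp add: x_def power_mult power_mult[of _ c] mult.commute[of c])
  have k: "k \<ge> 1" using assms by simp
  \<comment> \<open>Each rank sums the closed forms along \<open>s + d = i\<close>. For
    \<open>i = 8\<close> only state \<open>(4, 4, True)\<close> remains, and its constant term 16 *
    16 * 32 * 64 * 128 is the \<open>2 ^ 26\<close> of the claim.\<close>
  note counts = state_count_closed[OF assms, folded x_def, unfolded One_nat_def]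
    state_count_vanish state_count_4_False[OF k]
  have range: "{..4} = {0, 1, 2, 3, 4 :: nat}" by auto
  show ?thesis
    unfolding Gamma4_eq_sum_state_count[OF k] x range x_def[symmetric]
    by (intro conjI; simp add: counts; simp add: algebra_simps power2_eq_square power3_eq_cube power4_eq_xxxx)
qed

end
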